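(* For any competitive economy $(m,\mathcal Z)$, the set of Walrasian equilibria is equal to the strictly positive cone generated by the set of strong solutions of the variational inequality $(\Delta_m,-\mathcal Z)$, i.e., $$\mathrm{WE}(m,\mathcal Z)=\bigcup_{\lambda>0}\lambda\,\mathrm{SVI}(\Delta_m,-\mathcal Z).$$
   Context: $\Delta_m=\{p\in\mathbb{R}^m_+:\sum_j p_j=1\}$. A Walrasian economy $(m,\mathcal Z)$ consists of $m\in\mathbb N$ commodities and an excess demand correspondence $\mathcal Z:\mathbb{R}^m_+\rightrightarrows\mathbb{R}^m$. It is competitive if (i) $\mathcal Z(\lambda p)=\mathcal Z(p)$ for all $\lambda>0$ (homogeneity of degree $0$); (ii) $p\cdot z\le0$ for all $p\in\mathbb{R}^m_+$, $z\in\mathcal Z(p)$ (weak Walras' law); (iii) for all $p\in\mathbb{R}^m_+$ and $z\in\mathcal Z(p)$, $z\le 0$ (componentwise) implies $p\cdot z=0$ (non-satiation). A Walrasian equilibrium is a $p^*\in\mathbb{R}^m_+$ for which there is $z\in\mathcal Z(p^* )$ with $z_j\le0$ for all $j$ and $p^*\cdot z=0$; $\mathrm{WE}(m,\mathcal Z)$ is the set of these. A strong solution of a variational inequality $(X,\mathcal F)$, with constraint set $X$ and set-valued operator $\mathcal F$, is an $x^*\in X$ such that for all $x\in X$ there exists $f\in\mathcal F(x^* )$ with $\langle f,x^*-x\rangle\le0$; $\mathrm{SVI}(X,\mathcal F)$ is the set of these. For a set $A$ and scalar $\lambda$, $\lambda A=\{\lambda a: a\in A\}$.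
   Formalization: The zero price vector is removed from WE (it can be an equilibrium, e.g. Z(p)={0}, but lies on no ray through the simplex), and in a strong solution one f in F(x* ) must serve all x, since letting f depend on x makes the claim false for non-convex-valued Z. *)

theory Defs
  imports "HOL-Analysis.Analysis"
begin

text \<open>
  An economy with \<open>CARD('m)\<close> commodities is given by its excess demand correspondence
  \<open>Z :: real ^ 'm \<Rightarrow> (real ^ 'm) set\<close>; only its values on the nonnegative orthant matter,
  and they may be empty.
\<close>

definition orthant :: "(real ^ 'm) set" where
  "orthant = {p. \<forall>j. 0 \<le> p $ j}"

definition price_simplex :: "(real ^ 'm) set" where
  "price_simplex = {p \<in> orthant. (\<Sum>j\<in>UNIV. p $ j) = 1}"

definition competitive :: "(real ^ 'm \<Rightarrow> (real ^ 'm) set) \<Rightarrow> bool" where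
  "competitive Z \<longleftrightarrow>
     (\<forall>p\<in>orthant. \<forall>l>0. Z (l *\<^sub>R p) = Z p) \<and>
     (\<forall>p\<in>orthant. \<forall>z\<in>Z p. p \<bullet> z \<le> 0) \<and>
     (\<forall>p\<in>orthant. \<forall>z\<in>Z p. (\<forall>j. z $ j \<le> 0) \<longrightarrow> p \<bullet> z = 0)"

text \<open>
  The zero price vector belongs to \<open>WE Z\<close> whenever \<open>Z 0\<close> has a nonpositive element, for instance
  if \<open>Z p = {0}\<close> for all \<open>p\<close>.  It lies on no ray through the simplex, so a description of the
  equilibria by such rays can only concern \<open>WE Z - {0}\<close>.
\<close>

definition WE :: "(real ^ 'm \<Rightarrow> (real ^ 'm) set) \<Rightarrow> (real ^ 'm) set" where
  "WE Z = {p \<in> orthant. \<exists>z\<in>Z p. (\<forall>j. z $ j \<le> 0) \<and> p \<bullet> z = 0}"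

text \<open>
  In a strong solution one and the same \<open>f\<close> serves all \<open>x\<close>.  If \<open>f\<close> were allowed to depend on \<open>x\<close>,
  a strong solution for \<open>- Z\<close> need not be an equilibrium when the values of \<open>Z\<close> are not convex:
  for two commodities, take \<open>Z p = {(1, -1), (-1, 1)}\<close> where the two prices are equal and
  \<open>Z p = {0}\<close> elsewhere.
\<close>

definition SVI :: "'a::real_inner set \<Rightarrow> ('a \<Rightarrow> 'a set) \<Rightarrow> 'a set" where
  "SVI X F = {x' \<in> X. \<exists>f\<in>F x'. \<forall>x\<in>X. f \<bullet> (x' - x) \<le> 0}"

end

theory Submission
  imports Defs
begin

text \<open>
  On the simplex, equilibria and strong solutions coincide: testing the variational inequality
  against the vertices bounds every \<open>z $ j\<close> by \<open>p \<bullet> z \<le> 0\<close>, and conversely \<open>z \<le> 0\<close> gives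
  \<open>z \<bullet> x \<le> 0 = z \<bullet> p\<close> for every \<open>x\<close> in the simplex. By homogeneity the equilibria form a cone,
  and each nonzero one is normalised into the simplex by its coordinate sum.
\<close>

lemma axis_in_price_simplex: "axis j 1 \<in> price_simplex"
  by (auto simp: price_simplex_def orthant_def axis_def)

lemma inner_nonpos_of_orthant:
  assumes "x \<in> orthant" "\<And>j. z $ j \<le> 0"
  shows "z \<bullet> x \<le> 0"
  unfolding inner_vec_def
  using assms by (intro sum_nonpos) (auto simp: orthant_def mult_le_0_iff)

lemma SVI_price_simplex_eq:
  assumes "competitive Z"
  shows "SVI price_simplex (\<lambda>p. uminus ` Z p) = WE Z \<inter> price_simplex"
proof (intro equalityI subsetI)
  fix p assume "p \<in> SVI price_simplex (\<lambda>p. uminus ` Z p)"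
  then obtain z where p: "p \<in> price_simplex" and z: "z \<in> Z p"
    and var: "\<And>x. x \<in> price_simplex \<Longrightarrow> - z \<bullet> (p - x) \<le> 0"
    by (auto simp: SVI_def)
  have orth: "p \<in> orthant" using p by (simp add: price_simplex_def)
  have "z $ j \<le> 0" for j
  proof -
    have "z $ j \<le> p \<bullet> z"
      using var[OF axis_in_price_simplex[of j]]
      by (simp add: inner_diff_right inner_axis inner_commute)
    \<comment> \<open>This is the weak Walras law; together with the test at the vertex
      \<open>axis j 1\<close> it bounds every coordinate.\<close>
    also have "\<dots> \<le> 0"
      using assms orth z by (auto simp: competitive_def)
    finally show ?thesis .
  qed
  \<comment> \<open>Non-satiation turns the inequality of Walras' law into an equality, now that
    \<open>z\<close> is known to be nonpositive.\<close>
  moreover from this have "p \<bullet> z = 0"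
    using assms orth z by (auto simp: competitive_def)
  ultimately show "p \<in> WE Z \<inter> price_simplex"
    using p orth z by (auto simp: WE_def)
next
  fix p assume "p \<in> WE Z \<inter> price_simplex"
  then obtain z where p: "p \<in> price_simplex" and z: "z \<in> Z p"
    and nonpos: "\<And>j. z $ j \<le> 0" and "p \<bullet> z = 0"
    by (auto simp: WE_def)
  then have "- z \<bullet> (p - x) \<le> 0" if "x \<in> price_simplex" for x
    using inner_nonpos_of_orthant[of x z] that
    by (simp add: price_simplex_def inner_diff_right inner_commute)
  with p z show "p \<in> SVI price_simplex (\<lambda>p. uminus ` Z p)"
    unfolding SVI_def by blast
qed

text \<open>Homogeneity gives \<open>Z\<close> the same value along the ray, so the \<open>z\<close>
  that witnesses \<open>p\<close> also witnesses \<open>l *\<^sub>R p\<close>.\<close>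

lemma WE_scaleR:
  assumes "competitive Z" "p \<in> WE Z" "0 < l"
  shows "l *\<^sub>R p \<in> WE Z"
proof -
  have "Z (l *\<^sub>R p) = Z p"
    using assms by (auto simp: competitive_def WE_def)
  with assms show ?thesis
    by (auto simp: WE_def orthant_def)
qed

text \<open>Keeps the origin out of every positive multiple of the simplex, matching the removal of
  \<open>0\<close> from \<open>WE Z\<close>.\<close>

lemma zero_notin_price_simplex: "0 \<notin> price_simplex"
  by (simp add: price_simplex_def)

lemma sum_pos_of_orthant:
  assumes "p \<in> orthant" "p \<noteq> 0"
  shows "0 < (\<Sum>j\<in>UNIV. p $ j)"
proof -
  obtain j where "p $ j \<noteq> 0"
    using assms(2) by (auto simp: vec_eq_iff)
  with assms(1) show ?thesis
    by (intro sum_pos2[of UNIV j]) (auto simp: orthant_def less_le)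
qed

theorem theorem4p4:
  fixes Z :: "real ^ 'm \<Rightarrow> (real ^ 'm) set"
  assumes "competitive Z"
  shows "WE Z - {0} = (\<Union>l\<in>{0<..}. (\<lambda>p. l *\<^sub>R p) ` SVI price_simplex (\<lambda>p. uminus ` Z p))"
  \<comment> \<open>After this rewriting only a statement about the cone \<open>WE Z\<close> and its
    slice by the simplex remains.\<close>
  unfolding SVI_price_simplex_eq[OF assms]
proof (intro equalityI subsetI)
  fix p assume p: "p \<in> WE Z - {0}"
  \<comment> \<open>Every point of \<open>l *\<^sub>R price_simplex\<close> has coordinate sum
    \<open>l\<close>, so \<open>s\<close> is the only possible ray parameter for
    \<open>p\<close>.\<close>
  define s where "s = (\<Sum>j\<in>UNIV. p $ j)"
  have orth: "p \<in> orthant" using p by (simp add: WE_def)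
  then have s: "0 < s"
    using p sum_pos_of_orthant by (auto simp: s_def)
  have "inverse s *\<^sub>R p \<in> price_simplex"
    using orth s
    by (auto simp: price_simplex_def orthant_def sum_distrib_left[symmetric] s_def[symmetric])
  moreover have "inverse s *\<^sub>R p \<in> WE Z"
    using WE_scaleR[OF assms] p s by simp
  moreover have "p = s *\<^sub>R (inverse s *\<^sub>R p)"
    using s by simp
  ultimately show "p \<in> (\<Union>l\<in>{0<..}. (\<lambda>p. l *\<^sub>R p) ` (WE Z \<inter> price_simplex))"
    using s by blast
next
  fix p assume "p \<in> (\<Union>l\<in>{0<..}. (\<lambda>p. l *\<^sub>R p) ` (WE Z \<inter> price_simplex))"
  then show "p \<in> WE Z - {0}"
    using WE_scaleR[OF assms] zero_notin_price_simplex by auto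
qed

end
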